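(* Let $u_1,\dots,u_n\in\mathbf{R}^d$ be distinct vectors, let $1\le k\le n$, and let $\alpha_1>\alpha_2>\cdots>\alpha_n>0$ be real numbers. Let $P_k$ be the $k$-ordertope $$P_k=\operatorname{conv}\Big\{\sum_{i=1}^k \alpha_i u_{\sigma_i} \;:\; \sigma_1,\dots,\sigma_k\in\{1,\dots,n\}\text{ pairwise distinct}\Big\}.$$ Then for every choice of pairwise distinct indices $\sigma_1,\dots,\sigma_k\in\{1,\dots,n\}$, the point $\sum_{i=1}^k\alpha_i u_{\sigma_i}\in P_k$ is a vertex of $P_k$ if and only if there is a vector $c\in\mathbf{R}^d$ (a linear scoring scheme) satisfying $$c\cdot u_{\sigma_1}>c\cdot u_{\sigma_2}>\cdots>c\cdot u_{\sigma_k}\quad\text{and}\quad c\cdot u_{\sigma_k}>c\cdot u_j\ \text{ for all } j\in\{1,\dots,n\}\setminus\{\sigma_1,\dots,\sigma_k\}.$$ Moreover, the normal fan of $P_k$ is independent of the choice of weights: for fixed $u_1,\dots,u_n$ and $k$, any two sequences of weights $\alpha_1>\cdots>\alpha_n>0$ and $\alpha'_1>\cdots>\alpha'_n>0$ yield $k$-ordertopes with the same normal fan.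
   Context: For a polytope $P\subset\mathbf{R}^d$ (convex hull of a finite nonempty set) and $c\in\mathbf{R}^d$, the face $F_c$ of $P$ is $\{x\in P: c\cdot x=\max_{y\in P}c\cdot y\}$; in particular $F_0=P$. A vertex of $P$ is a face consisting of a single point. The normal cone $N(F)$ of a face $F$ of $P$ is the closed cone of all $c\in\mathbf{R}^d$ with $F\subseteq F_c$ (its relative interior is the set of $c$ with $F_c=F$). The normal fan of $P$ is the set of normal cones $N(F)$ of all faces $F$ of $P$. *)

theory Defs
  imports "HOL-Analysis.Analysis"
begin

section \<open>Faces, vertices and the normal fan of a polytope\<close>

text \<open>
  The face \<open>F\<^sub>c\<close> of \<open>P\<close>: the points of \<open>P\<close> at which \<open>c \<bullet> _\<close> attains its maximum over \<open>P\<close>.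
  Faces are exactly these sets, so that a face of a nonempty polytope is nonempty and \<open>P\<close>
  itself is a face (\<open>c = 0\<close>). The library predicates \<open>face_of\<close> and \<open>exposed_face_of\<close> differ in
  that they also admit the empty set.
\<close>

definition max_face :: "'a::euclidean_space set \<Rightarrow> 'a \<Rightarrow> 'a set" where
  "max_face P c = {x \<in> P. \<forall>y\<in>P. c \<bullet> y \<le> c \<bullet> x}"

definition is_face :: "'a::euclidean_space set \<Rightarrow> 'a set \<Rightarrow> bool" where
  "is_face P F \<longleftrightarrow> (\<exists>c. F = max_face P c)"

definition is_vertex :: "'a::euclidean_space set \<Rightarrow> 'a \<Rightarrow> bool" where
  "is_vertex P v \<longleftrightarrow> is_face P {v}"

definition normal_cone :: "'a::euclidean_space set \<Rightarrow> 'a set \<Rightarrow> 'a set" where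
  "normal_cone P F = {c. F \<subseteq> max_face P c}"

definition normal_fan :: "'a::euclidean_space set \<Rightarrow> 'a set set" where
  "normal_fan P = {normal_cone P F | F. is_face P F}"

section \<open>Ordertopes\<close>

text \<open>
  Finite sequences are functions on \<open>nat\<close> of which only the values at \<open>1, \<dots>, n\<close> (for the
  vectors and the weights) or at \<open>1, \<dots>, k\<close> (for the chosen indices) are relevant.
\<close>

definition weights :: "nat \<Rightarrow> (nat \<Rightarrow> real) \<Rightarrow> bool" where
  "weights n \<alpha> \<longleftrightarrow> (\<forall>i\<in>{1..<n}. \<alpha> i > \<alpha> (Suc i)) \<and> \<alpha> n > 0"

definition selection :: "nat \<Rightarrow> nat \<Rightarrow> (nat \<Rightarrow> nat) \<Rightarrow> bool" where
  "selection n k \<sigma> \<longleftrightarrow> \<sigma> ` {1..k} \<subseteq> {1..n} \<and> inj_on \<sigma> {1..k}"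

definition ordertope ::
    "nat \<Rightarrow> nat \<Rightarrow> (nat \<Rightarrow> real) \<Rightarrow> (nat \<Rightarrow> 'a::euclidean_space) \<Rightarrow> 'a set" where
  "ordertope n k \<alpha> u = convex hull {(\<Sum>i=1..k. \<alpha> i *\<^sub>R u (\<sigma> i)) | \<sigma>. selection n k \<sigma>}"

end

(* For a linear functional c write a j = c . u j. Exchanging two entries of a selection, or its
   last entry with an unused index, changes the weighted sum by a positive multiple of a
   difference of two of the u j. Hence a maximizing selection lists the largest values of a in
   weakly decreasing order. Conversely, two selections with this property have the same sequence
   of values of a, so that all of them are maximizing. Which selections span the face F_c
   therefore depends only on the order of the values a j and not on the weights. If the order is
   strict there is only one such selection, and if F_c is a single point then every exchange
   strictly decreases the value of c. *)
theory Submission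
  imports Defs
begin

section \<open>Weighted sums along a selection and sorted selections\<close>

text \<open>Polymorphic on purpose: it is used for the vectors \<open>u j\<close> and for the reals
  \<open>c \<bullet> u j\<close>, where \<open>*\<^sub>R\<close> is multiplication. A linear
  functional thus turns one use into the other.\<close>

definition selection_point ::
    "nat \<Rightarrow> (nat \<Rightarrow> real) \<Rightarrow> (nat \<Rightarrow> 'a::real_vector) \<Rightarrow> (nat \<Rightarrow> nat) \<Rightarrow> 'a" where
  "selection_point k \<alpha> u \<sigma> = (\<Sum>i=1..k. \<alpha> i *\<^sub>R u (\<sigma> i))"

text \<open>The weights do not enter here; this is what later makes the normal fan independent of
  them.\<close>

definition sorted_selection :: "nat \<Rightarrow> nat \<Rightarrow> (nat \<Rightarrow> real) \<Rightarrow> (nat \<Rightarrow> nat) \<Rightarrow> bool" where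
  "sorted_selection n k a \<sigma> \<longleftrightarrow>
     (\<forall>i\<in>{1..<k}. a (\<sigma> (Suc i)) \<le> a (\<sigma> i)) \<and> (\<forall>j\<in>{1..n} - \<sigma> ` {1..k}. a j \<le> a (\<sigma> k))"

definition strictly_sorted_selection :: "nat \<Rightarrow> nat \<Rightarrow> (nat \<Rightarrow> real) \<Rightarrow> (nat \<Rightarrow> nat) \<Rightarrow> bool" where
  "strictly_sorted_selection n k a \<sigma> \<longleftrightarrow>
     (\<forall>i\<in>{1..<k}. a (\<sigma> (Suc i)) < a (\<sigma> i)) \<and> (\<forall>j\<in>{1..n} - \<sigma> ` {1..k}. a j < a (\<sigma> k))"

lemma inner_selection_point:
  "c \<bullet> selection_point k \<alpha> u \<sigma> = selection_point k \<alpha> (\<lambda>j. c \<bullet> u j) \<sigma>"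
  by (simp add: selection_point_def inner_sum_right)

lemma selection_point_cong:
  assumes "\<And>i. i \<in> {1..k} \<Longrightarrow> u (\<sigma> i) = u (\<tau> i)"
  shows "selection_point k \<alpha> u \<sigma> = selection_point k \<alpha> u \<tau>"
  using assms by (simp add: selection_point_def)

section \<open>Weights and exchanges\<close>

lemma weights_decreasing: "weights n \<alpha> \<Longrightarrow> i \<in> {1..<n} \<Longrightarrow> \<alpha> (Suc i) < \<alpha> i"
  by (simp add: weights_def)

text \<open>Positivity is given at \<open>n\<close> only and is carried down to \<open>k\<close> by
  descending induction along the decreasing weights.\<close>

lemma weights_pos:
  assumes "weights n \<alpha>" "1 \<le> k" "k \<le> n"
  shows "\<alpha> k > 0"
  using \<open>k \<le> n\<close>
proof (induction k rule: inc_induct)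
  case base
  then show ?case using assms by (simp add: weights_def)
next
  case (step m)
  then show ?case
    using assms(2) weights_decreasing[OF assms(1), of m] by simp
qed

lemma selection_mem: "selection n k \<sigma> \<Longrightarrow> i \<in> {1..k} \<Longrightarrow> \<sigma> i \<in> {1..n}"
  unfolding selection_def by blast

text \<open>The exchange is composition with a transposition, which permutes
  \<open>{1..k}\<close>.\<close>

lemma selection_swap:
  assumes "selection n k \<sigma>" "i \<in> {1..<k}"
  shows "selection n k (\<sigma>(i := \<sigma> (Suc i), Suc i := \<sigma> i))"
proof -
  have swap: "\<sigma>(i := \<sigma> (Suc i), Suc i := \<sigma> i) = \<sigma> \<circ> Transposition.transpose i (Suc i)"
    by (auto simp: fun_eq_iff Transposition.transpose_def)
  have "Transposition.transpose i (Suc i) ` {1..k} = {1..k}"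
    using assms(2) by (intro transpose_image_eq) auto
  with assms(1) show ?thesis
    unfolding swap selection_def by (auto simp: image_comp[symmetric] intro!: comp_inj_on)
qed

text \<open>Only the summands at \<open>i\<close> and \<open>Suc i\<close> differ. The coefficient
  \<open>\<alpha> i - \<alpha> (Suc i)\<close> is positive for weights, so the sign of the change is
  that of the difference of the two entries.\<close>

lemma selection_point_swap:
  assumes "i \<in> {1..<k}"
  shows "selection_point k \<alpha> u (\<sigma>(i := \<sigma> (Suc i), Suc i := \<sigma> i)) =
    selection_point k \<alpha> u \<sigma> + (\<alpha> i - \<alpha> (Suc i)) *\<^sub>R (u (\<sigma> (Suc i)) - u (\<sigma> i))"
proof -
  define R where "R = {1..k} - {i, Suc i}"
  have *: "{1..k} = insert i (insert (Suc i) R)"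
    using assms by (auto simp: R_def)
  have split: "selection_point k \<alpha> u \<tau> =
      \<alpha> i *\<^sub>R u (\<tau> i) + (\<alpha> (Suc i) *\<^sub>R u (\<tau> (Suc i)) + (\<Sum>l\<in>R. \<alpha> l *\<^sub>R u (\<tau> l)))" for \<tau>
    unfolding selection_point_def * by (simp add: R_def)
  define \<tau> where "\<tau> = \<sigma>(i := \<sigma> (Suc i), Suc i := \<sigma> i)"
  have "(\<Sum>l\<in>R. \<alpha> l *\<^sub>R u (\<tau> l)) = (\<Sum>l\<in>R. \<alpha> l *\<^sub>R u (\<sigma> l))"
    by (rule sum.cong) (auto simp: R_def \<tau>_def)
  moreover have "\<tau> i = \<sigma> (Suc i)" "\<tau> (Suc i) = \<sigma> i"
    by (simp_all add: \<tau>_def)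
  ultimately have "selection_point k \<alpha> u \<tau> =
      selection_point k \<alpha> u \<sigma> + (\<alpha> i - \<alpha> (Suc i)) *\<^sub>R (u (\<sigma> (Suc i)) - u (\<sigma> i))"
    unfolding split by (simp add: scaleR_diff_left scaleR_diff_right)
  then show ?thesis
    unfolding \<tau>_def .
qed

lemma selection_replace_last:
  assumes "selection n k \<sigma>" "j \<in> {1..n} - \<sigma> ` {1..k}"
  shows "selection n k (\<sigma>(k := j))"
  using assms unfolding selection_def by (auto intro: inj_on_fun_updI)

lemma selection_point_replace_last:
  assumes "1 \<le> k"
  shows "selection_point k \<alpha> u (\<sigma>(k := j)) = selection_point k \<alpha> u \<sigma> + \<alpha> k *\<^sub>R (u j - u (\<sigma> k))"
proof -
  have *: "{1..k} = insert k {1..<k}"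
    using assms by auto
  show ?thesis
    unfolding selection_point_def * by (simp add: algebra_simps)
qed

lemma sorted_if_maximal:
  assumes "weights n \<alpha>" "1 \<le> k" "k \<le> n" "selection n k \<sigma>"
    and max: "\<And>\<tau>. selection n k \<tau> \<Longrightarrow> selection_point k \<alpha> a \<tau> \<le> selection_point k \<alpha> a \<sigma>"
  shows "sorted_selection n k a \<sigma>"
  unfolding sorted_selection_def
proof (intro conjI ballI)
  fix i assume i: "i \<in> {1..<k}"
  then show "a (\<sigma> (Suc i)) \<le> a (\<sigma> i)"
    using max[OF selection_swap[OF assms(4) i]] weights_decreasing[OF assms(1), of i] assms(3)
    unfolding selection_point_swap[OF i] by (simp add: mult_le_0_iff)
next
  fix j assume j: "j \<in> {1..n} - \<sigma> ` {1..k}"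
  then show "a j \<le> a (\<sigma> k)"
    using max[OF selection_replace_last[OF assms(4) j]] weights_pos[OF assms(1-3)]
    unfolding selection_point_replace_last[OF assms(2)] by (simp add: mult_le_0_iff)
qed

section \<open>Comparison of sorted selections\<close>

lemma sorted_selection_antimono:
  assumes "sorted_selection n k a \<sigma>" "1 \<le> i" "i \<le> j" "j \<le> k"
  shows "a (\<sigma> j) \<le> a (\<sigma> i)"
  using \<open>i \<le> j\<close> \<open>j \<le> k\<close>
proof (induction j rule: dec_induct)
  case (step m)
  then have "a (\<sigma> (Suc m)) \<le> a (\<sigma> m)"
    using assms(1,2) by (simp add: sorted_selection_def)
  with step show ?case by simp
qed simp

text \<open>A pigeonhole argument. One inequality is enough, since exchanging the roles of
  \<open>\<sigma>\<close> and \<open>\<tau>\<close> gives the other.\<close>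

lemma sorted_selection_le:
  assumes "selection n k \<sigma>" "sorted_selection n k a \<sigma>" "sorted_selection n k a \<tau>" "i \<in> {1..k}"
  shows "a (\<sigma> i) \<le> a (\<tau> i)"
proof (rule ccontr)
  assume less: "\<not> a (\<sigma> i) \<le> a (\<tau> i)"
  \<comment> \<open>Otherwise the first \<open>i\<close> entries of \<open>\<sigma>\<close> would occur among the first \<open>i - 1\<close> entries of \<open>\<tau>\<close>.\<close>
  have "\<sigma> ` {1..i} \<subseteq> \<tau> ` {1..<i}"
  proof (rule image_subsetI)
    fix m assume m: "m \<in> {1..i}"
    have gt: "a (\<tau> i) < a (\<sigma> m)"
      using sorted_selection_antimono[OF assms(2), of m i] m assms(4) less by simp
    have "a (\<tau> k) \<le> a (\<tau> i)"
      using sorted_selection_antimono[OF assms(3), of i k] assms(4) by simp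
    moreover have "\<sigma> m \<in> {1..n}"
      using selection_mem[OF assms(1), of m] assms(4) m by simp
    moreover have "a j \<le> a (\<tau> k)" if "j \<in> {1..n} - \<tau> ` {1..k}" for j
      using assms(3) that by (simp add: sorted_selection_def)
    ultimately have "\<sigma> m \<in> \<tau> ` {1..k}"
      using gt by (meson DiffI dual_order.trans leD)
    then obtain l where l: "l \<in> {1..k}" "\<sigma> m = \<tau> l" by blast
    \<comment> \<open>For \<open>i \<le> l\<close> the value \<open>a (\<tau> l)\<close>, which is
      \<open>a (\<sigma> m)\<close>, would be at most \<open>a (\<tau> i)\<close>.\<close>
    have "l < i"
      using sorted_selection_antimono[OF assms(3), of i l] assms(4) l gt by fastforce
    with l show "\<sigma> m \<in> \<tau> ` {1..<i}" by auto
  qed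
  then have "card (\<sigma> ` {1..i}) \<le> card (\<tau> ` {1..<i})"
    by (intro card_mono) auto
  also have "\<dots> \<le> i - 1"
    using card_image_le[of "{1..<i}" \<tau>] by simp
  also have "card (\<sigma> ` {1..i}) = i"
    using assms(1,4) by (subst card_image) (auto simp: selection_def intro: inj_on_subset)
  finally show False using assms(4) by fastforce
qed

lemma sorted_selection_values_unique:
  assumes "selection n k \<sigma>" "sorted_selection n k a \<sigma>" "selection n k \<tau>" "sorted_selection n k a \<tau>"
    and "i \<in> {1..k}"
  shows "a (\<sigma> i) = a (\<tau> i)"
  using assms by (intro antisym sorted_selection_le) auto

lemma strictly_sorted_imp_sorted:
  "strictly_sorted_selection n k a \<sigma> \<Longrightarrow> sorted_selection n k a \<sigma>"
  unfolding strictly_sorted_selection_def sorted_selection_def by (simp add: less_imp_le)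

lemma strictly_sorted_selection_unique:
  assumes "selection n k \<sigma>" "strictly_sorted_selection n k a \<sigma>"
    and "selection n k \<tau>" "sorted_selection n k a \<tau>" and i: "i \<in> {1..k}"
  shows "\<tau> i = \<sigma> i"
proof -
  have sorted: "sorted_selection n k a \<sigma>"
    using assms(2) by (rule strictly_sorted_imp_sorted)
  have eq: "a (\<sigma> i) = a (\<tau> i)"
    using sorted_selection_values_unique[OF assms(1) sorted assms(3,4) i] .
  have less: "a (\<sigma> l) < a (\<sigma> m)" if "1 \<le> m" "m < l" "l \<le> k" for m l
  proof -
    have "a (\<sigma> l) \<le> a (\<sigma> (Suc m))"
      using sorted_selection_antimono[OF sorted, of "Suc m" l] that by simp
    also have "\<dots> < a (\<sigma> m)"
      using assms(2) that by (simp add: strictly_sorted_selection_def)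
    finally show ?thesis .
  qed
  have "\<tau> i \<in> {1..n}"
    using selection_mem[OF assms(3) i] .
  moreover have "a (\<sigma> k) \<le> a (\<sigma> i)"
    using sorted_selection_antimono[OF sorted, of i k] i by simp
  moreover have "a j < a (\<sigma> k)" if "j \<in> {1..n} - \<sigma> ` {1..k}" for j
    using assms(2) that by (simp add: strictly_sorted_selection_def)
  ultimately have "\<tau> i \<in> \<sigma> ` {1..k}"
    using eq by (metis DiffI leD)
  then obtain l where "l \<in> {1..k}" "\<tau> i = \<sigma> l" by blast
  with less[of i l] less[of l i] eq i show ?thesis
    by (cases i l rule: linorder_cases) auto
qed

section \<open>Maximal selections\<close>

lemma selection_id: "k \<le> n \<Longrightarrow> selection n k id"
  by (auto simp: selection_def)

text \<open>Selections are unconstrained outside \<open>{1..k}\<close>, so the selections themselves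
  are not finite in number. Restricting them to \<open>{1..k}\<close> keeps the point and leaves
  finitely many functions.\<close>

lemma finite_selection_points:
  "finite {selection_point k \<alpha> u \<sigma> | \<sigma>. selection n k \<sigma>}"
proof (rule finite_subset)
  show "{selection_point k \<alpha> u \<sigma> | \<sigma>. selection n k \<sigma>} \<subseteq>
      selection_point k \<alpha> u ` ({1..k} \<rightarrow>\<^sub>E {1..n})"
  proof safe
    fix \<sigma> assume "selection n k \<sigma>"
    then have "restrict \<sigma> {1..k} \<in> {1..k} \<rightarrow>\<^sub>E {1..n}"
      using selection_mem by (simp add: PiE_iff extensional_restrict)
    moreover have "selection_point k \<alpha> u \<sigma> = selection_point k \<alpha> u (restrict \<sigma> {1..k})"
      by (rule selection_point_cong) simp
    ultimately show "selection_point k \<alpha> u \<sigma> \<in> selection_point k \<alpha> u ` ({1..k} \<rightarrow>\<^sub>E {1..n})"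
      by blast
  qed
  show "finite (selection_point k \<alpha> u ` ({1..k} \<rightarrow>\<^sub>E {1..n}))"
    by (intro finite_imageI finite_PiE) auto
qed

text \<open>For the converse, finiteness provides some maximizer \<open>\<rho>\<close>. It is
  sorted, so it has the same values as any sorted \<open>\<sigma>\<close> and the same weighted
  sum.\<close>

lemma maximal_iff_sorted:
  assumes "weights n \<alpha>" "1 \<le> k" "k \<le> n" "selection n k \<sigma>"
  shows "(\<forall>\<tau>. selection n k \<tau> \<longrightarrow> selection_point k \<alpha> a \<tau> \<le> selection_point k \<alpha> a \<sigma>) \<longleftrightarrow>
    sorted_selection n k a \<sigma>"
proof
  assume "\<forall>\<tau>. selection n k \<tau> \<longrightarrow> selection_point k \<alpha> a \<tau> \<le> selection_point k \<alpha> a \<sigma>"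
  then show "sorted_selection n k a \<sigma>"
    using sorted_if_maximal[OF assms] by blast
next
  assume sorted: "sorted_selection n k a \<sigma>"
  let ?V = "{selection_point k \<alpha> a \<sigma> | \<sigma>. selection n k \<sigma>}"
  have fin: "finite ?V" by (rule finite_selection_points)
  have "?V \<noteq> {}" using selection_id[OF assms(3)] by blast
  with fin have "Max ?V \<in> ?V" by (rule Max_in)
  then obtain \<rho> where \<rho>: "selection n k \<rho>" "Max ?V = selection_point k \<alpha> a \<rho>" by blast
  have max: "selection_point k \<alpha> a \<tau> \<le> selection_point k \<alpha> a \<rho>" if "selection n k \<tau>" for \<tau>
    using Max_ge[OF fin, of "selection_point k \<alpha> a \<tau>"] that \<rho>(2) by auto
  have "sorted_selection n k a \<rho>"
    using sorted_if_maximal[OF assms(1-3) \<rho>(1) max] .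
  then have "selection_point k \<alpha> a \<rho> = selection_point k \<alpha> a \<sigma>"
    using sorted_selection_values_unique[OF \<rho>(1) _ assms(4) sorted]
    by (intro selection_point_cong)
  with max show "\<forall>\<tau>. selection n k \<tau> \<longrightarrow> selection_point k \<alpha> a \<tau> \<le> selection_point k \<alpha> a \<sigma>"
    by simp
qed

section \<open>Faces of convex hulls\<close>

text \<open>Link to the library notion of a face: a nonempty \<open>max_face\<close> is cut out by a
  supporting hyperplane, and \<open>face_of\<close> admits the empty set.\<close>

lemma max_face_face_of:
  assumes "convex P"
  shows "max_face P c face_of P"
proof (cases "max_face P c = {}")
  case False
  then obtain x where x: "x \<in> P" "\<And>y. y \<in> P \<Longrightarrow> c \<bullet> y \<le> c \<bullet> x"
    by (auto simp: max_face_def)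
  then have "max_face P c = P \<inter> {y. c \<bullet> y = c \<bullet> x}"
    by (auto simp: max_face_def intro: antisym)
  with face_of_Int_supporting_hyperplane_le[OF assms x(2)] show ?thesis by simp
qed simp

lemma max_face_subset_max_face_hull: "max_face V c \<subseteq> max_face (convex hull V) c"
proof
  fix x assume x: "x \<in> max_face V c"
  have "convex hull V \<subseteq> {y. c \<bullet> y \<le> c \<bullet> x}"
    using x by (intro hull_minimal convex_halfspace_le) (auto simp: max_face_def)
  with x show "x \<in> max_face (convex hull V) c"
    by (auto simp: max_face_def intro: hull_inc)
qed

text \<open>A face of the hull of a compact \<open>V\<close> is the hull of some
  \<open>W \<subseteq> V\<close>. The points of \<open>W\<close> maximize \<open>c\<close> over the
  hull, hence over \<open>V\<close>.\<close>

lemma max_face_convex_hull: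
  assumes "compact V"
  shows "max_face (convex hull V) c = convex hull (max_face V c)"
proof
  have face: "max_face (convex hull V) c face_of convex hull V"
    by (simp add: max_face_face_of)
  show "convex hull (max_face V c) \<subseteq> max_face (convex hull V) c"
    using face_of_imp_convex[OF face] max_face_subset_max_face_hull
    by (intro hull_minimal) auto
  obtain W where W: "W \<subseteq> V" "max_face (convex hull V) c = convex hull W"
    using face_of_convex_hull_subset[OF assms face] by blast
  have "W \<subseteq> max_face (convex hull V) c"
    unfolding W(2) by (rule hull_subset)
  with W(1) have "W \<subseteq> max_face V c"
    by (auto simp: max_face_def hull_inc)
  then show "max_face (convex hull V) c \<subseteq> convex hull (max_face V c)"
    unfolding W(2) by (rule hull_mono)
qed

text \<open>Normal cones are defined by inclusions of faces; this reduces such inclusions to the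
  generating points.\<close>

lemma max_face_convex_hull_subset_iff:
  assumes "compact V"
  shows "max_face (convex hull V) c \<subseteq> max_face (convex hull V) d \<longleftrightarrow> max_face V c \<subseteq> max_face V d"
proof
  assume "max_face (convex hull V) c \<subseteq> max_face (convex hull V) d"
  then have "max_face V c \<subseteq> V \<inter> max_face (convex hull V) d"
    using max_face_subset_max_face_hull[of V c] by (auto simp: max_face_def)
  then show "max_face V c \<subseteq> max_face V d"
    by (auto simp: max_face_def hull_inc)
next
  assume "max_face V c \<subseteq> max_face V d"
  then show "max_face (convex hull V) c \<subseteq> max_face (convex hull V) d"
    unfolding max_face_convex_hull[OF assms] by (rule hull_mono)
qed

section \<open>Faces and normal fan of the ordertope\<close>

lemma ordertope_eq_hull:
  "ordertope n k \<alpha> u = convex hull {selection_point k \<alpha> u \<sigma> | \<sigma>. selection n k \<sigma>}"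
  by (simp add: ordertope_def selection_point_def)

lemma max_face_selection_points:
  assumes "weights n \<alpha>" "1 \<le> k" "k \<le> n"
  shows "max_face {selection_point k \<alpha> u \<sigma> | \<sigma>. selection n k \<sigma>} c =
    {selection_point k \<alpha> u \<sigma> | \<sigma>. selection n k \<sigma> \<and> sorted_selection n k (\<lambda>j. c \<bullet> u j) \<sigma>}"
proof -
  have "sorted_selection n k (\<lambda>j. c \<bullet> u j) \<sigma> \<longleftrightarrow>
      (\<forall>\<tau>. selection n k \<tau> \<longrightarrow> c \<bullet> selection_point k \<alpha> u \<tau> \<le> c \<bullet> selection_point k \<alpha> u \<sigma>)"
    if "selection n k \<sigma>" for \<sigma>
    using maximal_iff_sorted[OF assms that, of "\<lambda>j. c \<bullet> u j"]
    by (simp add: inner_selection_point)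
  then show ?thesis
    unfolding max_face_def by blast
qed

text \<open>Several selections may give the same point. Sortedness can be read off from any of them,
  not just from some suitable representative.\<close>

lemma sorted_selection_iff_in_max_face:
  assumes "weights n \<alpha>" "1 \<le> k" "k \<le> n" "selection n k \<sigma>"
  shows "selection_point k \<alpha> u \<sigma> \<in> max_face {selection_point k \<alpha> u \<tau> | \<tau>. selection n k \<tau>} c
    \<longleftrightarrow> sorted_selection n k (\<lambda>j. c \<bullet> u j) \<sigma>"
  using maximal_iff_sorted[OF assms, of "\<lambda>j. c \<bullet> u j"] assms(4)
  by (auto simp: max_face_def inner_selection_point)

text \<open>The right-hand side does not mention \<open>\<alpha>\<close>: inclusion of faces becomes
  an implication between sortedness for \<open>c\<close> and for \<open>d\<close>.\<close>

lemma normal_cone_ordertope: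
  assumes "weights n \<alpha>" "1 \<le> k" "k \<le> n"
  shows "normal_cone (ordertope n k \<alpha> u) (max_face (ordertope n k \<alpha> u) c) =
    {d. \<forall>\<sigma>. selection n k \<sigma> \<and> sorted_selection n k (\<lambda>j. c \<bullet> u j) \<sigma> \<longrightarrow>
      sorted_selection n k (\<lambda>j. d \<bullet> u j) \<sigma>}"
  unfolding normal_cone_def ordertope_eq_hull
    max_face_convex_hull_subset_iff[OF finite_imp_compact[OF finite_selection_points]]
  using sorted_selection_iff_in_max_face[OF assms, of _ u]
    max_face_selection_points[OF assms, of u c] by auto

lemma normal_fan_ordertope:
  assumes "weights n \<alpha>" "1 \<le> k" "k \<le> n"
  shows "normal_fan (ordertope n k \<alpha> u) =
    range (\<lambda>c. {d. \<forall>\<sigma>. selection n k \<sigma> \<and> sorted_selection n k (\<lambda>j. c \<bullet> u j) \<sigma> \<longrightarrow>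
      sorted_selection n k (\<lambda>j. d \<bullet> u j) \<sigma>})"
proof -
  have "normal_fan (ordertope n k \<alpha> u) =
      range (\<lambda>c. normal_cone (ordertope n k \<alpha> u) (max_face (ordertope n k \<alpha> u) c))"
    by (auto simp: normal_fan_def is_face_def)
  then show ?thesis
    unfolding normal_cone_ordertope[OF assms] .
qed

section \<open>Vertices of the ordertope\<close>

lemma strictly_sorted_if_max_face_singleton:
  assumes "weights n \<alpha>" "1 \<le> k" "k \<le> n" "inj_on u {1..n}" "selection n k \<sigma>"
    and face: "max_face (ordertope n k \<alpha> u) c = {selection_point k \<alpha> u \<sigma>}"
  shows "strictly_sorted_selection n k (\<lambda>j. c \<bullet> u j) \<sigma>"
proof -
  \<comment> \<open>Such a point lies in the ordertope but outside the face, so its value is below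
    the maximum, which \<open>\<sigma>\<close> attains.\<close>
  have less: "c \<bullet> selection_point k \<alpha> u \<tau> < c \<bullet> selection_point k \<alpha> u \<sigma>"
    if "selection n k \<tau>" "selection_point k \<alpha> u \<tau> \<noteq> selection_point k \<alpha> u \<sigma>" for \<tau>
  proof -
    have \<tau>: "selection_point k \<alpha> u \<tau> \<in> ordertope n k \<alpha> u"
      unfolding ordertope_eq_hull using that(1) by (intro hull_inc) blast
    have \<sigma>: "selection_point k \<alpha> u \<sigma> \<in> max_face (ordertope n k \<alpha> u) c"
      by (simp add: face)
    have "selection_point k \<alpha> u \<tau> \<notin> max_face (ordertope n k \<alpha> u) c"
      using that(2) by (simp add: face)
    with \<tau> \<sigma> show ?thesis
      unfolding max_face_def by force
  qed
  have mem: "\<sigma> i \<in> {1..n}" if "i \<in> {1..k}" for i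
    using selection_mem[OF assms(5) that] .
  show ?thesis
    unfolding strictly_sorted_selection_def
  proof (intro conjI ballI)
    fix i assume i: "i \<in> {1..<k}"
    have \<alpha>: "\<alpha> (Suc i) < \<alpha> i"
      using weights_decreasing[OF assms(1), of i] i assms(3) by simp
    have "\<sigma> (Suc i) \<noteq> \<sigma> i"
      using assms(5) i unfolding selection_def by (auto dest: inj_onD)
    \<comment> \<open>Distinctness of the vectors enters here: it ensures that the exchange really
      moves the point, so that \<open>less\<close> applies.\<close>
    then have "u (\<sigma> (Suc i)) \<noteq> u (\<sigma> i)"
      using inj_onD[OF assms(4)] mem i by fastforce
    with \<alpha> have "c \<bullet> selection_point k \<alpha> u (\<sigma>(i := \<sigma> (Suc i), Suc i := \<sigma> i)) <
        c \<bullet> selection_point k \<alpha> u \<sigma>"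
      using i by (intro less selection_swap assms) (simp_all add: selection_point_swap)
    then show "c \<bullet> u (\<sigma> (Suc i)) < c \<bullet> u (\<sigma> i)"
      using \<alpha> by (simp add: selection_point_swap[OF i] inner_right_distrib inner_diff_right mult_less_0_iff)
  next
    fix j assume j: "j \<in> {1..n} - \<sigma> ` {1..k}"
    have \<alpha>: "\<alpha> k > 0"
      using weights_pos[OF assms(1-3)] .
    have "j \<noteq> \<sigma> k"
      using j assms(2) by auto
    then have "u j \<noteq> u (\<sigma> k)"
      using inj_onD[OF assms(4)] mem[of k] j assms(2) by fastforce
    with \<alpha> have "c \<bullet> selection_point k \<alpha> u (\<sigma>(k := j)) < c \<bullet> selection_point k \<alpha> u \<sigma>"
      by (intro less selection_replace_last assms j)
        (simp add: selection_point_replace_last[OF assms(2)])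
    then show "c \<bullet> u j < c \<bullet> u (\<sigma> k)"
      using \<alpha> by (simp add: selection_point_replace_last[OF assms(2)]
          inner_right_distrib inner_diff_right mult_less_0_iff)
  qed
qed

text \<open>By uniqueness all sorted selections give the same point, so the face is the hull of a
  single point.\<close>

lemma max_face_singleton_if_strictly_sorted:
  assumes "weights n \<alpha>" "1 \<le> k" "k \<le> n" "selection n k \<sigma>"
    and strict: "strictly_sorted_selection n k (\<lambda>j. c \<bullet> u j) \<sigma>"
  shows "max_face (ordertope n k \<alpha> u) c = {selection_point k \<alpha> u \<sigma>}"
proof -
  have "selection_point k \<alpha> u \<tau> = selection_point k \<alpha> u \<sigma>"
    if "selection n k \<tau>" "sorted_selection n k (\<lambda>j. c \<bullet> u j) \<tau>" for \<tau>
    using strictly_sorted_selection_unique[OF assms(4) strict that]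
    by (intro selection_point_cong) simp
  then have "max_face {selection_point k \<alpha> u \<tau> | \<tau>. selection n k \<tau>} c = {selection_point k \<alpha> u \<sigma>}"
    unfolding max_face_selection_points[OF assms(1-3)]
    using assms(4) strictly_sorted_imp_sorted[OF strict] by blast
  then show ?thesis
    unfolding ordertope_eq_hull
      max_face_convex_hull[OF finite_imp_compact[OF finite_selection_points]] by simp
qed

theorem theorem2p7:
  fixes u :: "nat \<Rightarrow> real ^ 'd" and n k :: nat
  assumes "inj_on u {1..n}" and "1 \<le> k" and "k \<le> n"
  shows "(\<forall>\<alpha>. weights n \<alpha> \<longrightarrow>
            (\<forall>\<sigma>. selection n k \<sigma> \<longrightarrow>
               (is_vertex (ordertope n k \<alpha> u) (\<Sum>i=1..k. \<alpha> i *\<^sub>R u (\<sigma> i)) \<longleftrightarrow>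
                (\<exists>c :: real ^ 'd.
                   (\<forall>i\<in>{1..<k}. c \<bullet> u (\<sigma> i) > c \<bullet> u (\<sigma> (Suc i))) \<and>
                   (\<forall>j\<in>{1..n} - \<sigma> ` {1..k}. c \<bullet> u (\<sigma> k) > c \<bullet> u j)))))
         \<and> (\<forall>\<alpha> \<alpha>'. weights n \<alpha> \<and> weights n \<alpha>' \<longrightarrow>
               normal_fan (ordertope n k \<alpha> u) = normal_fan (ordertope n k \<alpha>' u))"
proof (intro conjI allI impI)
  fix \<alpha> \<sigma> assume *: "weights n \<alpha>" "selection n k \<sigma>"
  \<comment> \<open>The same \<open>c\<close> serves as the direction exposing the vertex and as the
    scoring scheme.\<close>
  have "is_vertex (ordertope n k \<alpha> u) (selection_point k \<alpha> u \<sigma>) \<longleftrightarrow>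
      (\<exists>c. strictly_sorted_selection n k (\<lambda>j. c \<bullet> u j) \<sigma>)"
    unfolding is_vertex_def is_face_def
    using strictly_sorted_if_max_face_singleton[OF *(1) assms(2,3,1) *(2)]
      max_face_singleton_if_strictly_sorted[OF *(1) assms(2,3) *(2)] by metis
  then show "is_vertex (ordertope n k \<alpha> u) (\<Sum>i=1..k. \<alpha> i *\<^sub>R u (\<sigma> i)) \<longleftrightarrow>
      (\<exists>c. (\<forall>i\<in>{1..<k}. c \<bullet> u (\<sigma> i) > c \<bullet> u (\<sigma> (Suc i))) \<and>
        (\<forall>j\<in>{1..n} - \<sigma> ` {1..k}. c \<bullet> u (\<sigma> k) > c \<bullet> u j))"
    by (simp add: selection_point_def strictly_sorted_selection_def)
next
  fix \<alpha> \<alpha>' assume "weights n \<alpha> \<and> weights n \<alpha>'"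
  then show "normal_fan (ordertope n k \<alpha> u) = normal_fan (ordertope n k \<alpha>' u)"
    using assms(2,3) by (simp add: normal_fan_ordertope)
qed

end
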